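(* Let $G=(V,E)$ be a finite directed simple graph without self-loops and let $\alpha\in\mathbb{C}$ be a root of unity. For every $g\in\mathbb{C}^{\vec E}$, $$\begin{pmatrix}(B_\alpha g)^{\mathrm{out}}_\alpha\\ (B_\alpha g)^{\mathrm{in}}_\alpha\end{pmatrix}=\begin{pmatrix}A_\alpha & -I\\ D-I & 0\end{pmatrix}\begin{pmatrix}g^{\mathrm{out}}_\alpha\\ g^{\mathrm{in}}_\alpha\end{pmatrix}.$$
   Context: The graph $G$ may contain both $(u,v)$ and $(v,u)$. Write $u\rightarrow_G v$ (equivalently $v\leftarrow_G u$) if $(u,v)\in E$ and $(v,u)\notin E$, and $u\leftrightarrow_G v$ if both are in $E$. Let $E_U=\{\{u,v\}:(u,v)\in E\text{ or }(v,u)\in E\}$, $m=|E_U|$, and let $\vec E$ be the set of $2m$ directed edges obtained by orienting each element of $E_U$ in both directions; $\overrightarrow{uv}\in\vec E$ denotes the one with initial vertex $u$ and terminal vertex $v$, and $i_e,t_e$ are the initial and terminal vertices of $e$. Neighborhoods: $\overleftarrow{N_u}=\{v:u\leftarrow_G v\}$, $\overrightarrow{N_u}=\{v:u\rightarrow_G v\}$, $\overleftrightarrow{N_u}=\{v:u\leftrightarrow_G v\}$, $N_u$ their union; $d_u=|N_u|$, $D=\mathrm{diag}(d_u)_{u\in V}$. The Hermitian adjacency matrix $A_\alpha\in\mathbb{C}^{V\times V}$ has $(A_\alpha)_{uv}=1$ if $u\leftrightarrow_G v$, $\alpha$ if $u\rightarrow_G v$, $\bar\alpha$ if $u\leftarrow_G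 v$, $0$ otherwise. The matrix $B\in\mathbb{R}^{\vec E\times\vec E}$ has $B_{ef}=1$ if $t_e=i_f$ and $i_e\neq t_f$, else $0$. For $e\in\vec E$ let $\lambda_e=1$ if $i_e\leftrightarrow_G t_e$, $\alpha$ if $i_e\rightarrow_G t_e$, $\bar\alpha$ if $i_e\leftarrow_G t_e$; $B_\alpha=B\,\mathrm{diag}(\lambda_e)_{e\in\vec E}$. For $g\in\mathbb{C}^{\vec E}$, the in-vector and out-vector $g^{\mathrm{in}}_\alpha,g^{\mathrm{out}}_\alpha\in\mathbb{C}^V$ are $(g^{\mathrm{in}}_\alpha)_u=\sum_{v\in N_u}g_{\overrightarrow{vu}}$ and $(g^{\mathrm{out}}_\alpha)_u=\sum_{v\in\overleftrightarrow{N_u}}g_{\overrightarrow{uv}}+\alpha\sum_{v\in\overrightarrow{N_u}}g_{\overrightarrow{uv}}+\bar\alpha\sum_{v\in\overleftarrow{N_u}}g_{\overrightarrow{uv}}$. *)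

theory Defs
  imports Complex_Main "Graph_Theory.Pair_Digraph"
begin

text \<open>
  A matrix over finite index sets \<open>I\<close>, \<open>J\<close> is a function of two arguments, and a vector a function
  of one, of which only the values at indices in these sets matter. Products therefore take the set
  over which they sum as a parameter, and equations between vectors are stated on the index set.
\<close>

definition mat_mul :: "'j set \<Rightarrow> ('i \<Rightarrow> 'j \<Rightarrow> complex) \<Rightarrow> ('j \<Rightarrow> 'k \<Rightarrow> complex) \<Rightarrow> 'i \<Rightarrow> 'k \<Rightarrow> complex" where
  "mat_mul J M N = (\<lambda>i k. \<Sum>j\<in>J. M i j * N j k)"

definition mat_vec :: "'j set \<Rightarrow> ('i \<Rightarrow> 'j \<Rightarrow> complex) \<Rightarrow> ('j \<Rightarrow> complex) \<Rightarrow> 'i \<Rightarrow> complex" where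
  "mat_vec J M x = (\<lambda>i. \<Sum>j\<in>J. M i j * x j)"

definition diag :: "('i \<Rightarrow> complex) \<Rightarrow> 'i \<Rightarrow> 'i \<Rightarrow> complex" where
  "diag d = (\<lambda>i j. if i = j then d i else 0)"

definition id_mat :: "'i \<Rightarrow> 'i \<Rightarrow> complex" where
  "id_mat = diag (\<lambda>_. 1)"

definition zero_mat :: "'i \<Rightarrow> 'j \<Rightarrow> complex" where
  "zero_mat = (\<lambda>_ _. 0)"

text \<open>
  Blocks are indexed by disjoint sums: \<open>Inl\<close> is the first block row or column, \<open>Inr\<close> the second.
\<close>

definition block_vec :: "('i \<Rightarrow> complex) \<Rightarrow> ('j \<Rightarrow> complex) \<Rightarrow> 'i + 'j \<Rightarrow> complex" where
  "block_vec x y = case_sum x y"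

definition block_mat ::
  "('i \<Rightarrow> 'k \<Rightarrow> complex) \<Rightarrow> ('i \<Rightarrow> 'l \<Rightarrow> complex) \<Rightarrow>
   ('j \<Rightarrow> 'k \<Rightarrow> complex) \<Rightarrow> ('j \<Rightarrow> 'l \<Rightarrow> complex) \<Rightarrow> 'i + 'j \<Rightarrow> 'k + 'l \<Rightarrow> complex" where
  "block_mat P Q R S =
     case_sum (\<lambda>i. case_sum (P i) (Q i)) (\<lambda>j. case_sum (R j) (S j))"

definition one_way :: "'v pair_pre_digraph \<Rightarrow> 'v \<Rightarrow> 'v \<Rightarrow> bool" where
  "one_way G u v \<longleftrightarrow> (u, v) \<in> parcs G \<and> (v, u) \<notin> parcs G"

definition two_way :: "'v pair_pre_digraph \<Rightarrow> 'v \<Rightarrow> 'v \<Rightarrow> bool" where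
  "two_way G u v \<longleftrightarrow> (u, v) \<in> parcs G \<and> (v, u) \<in> parcs G"

definition und_edges :: "'v pair_pre_digraph \<Rightarrow> 'v set set" where
  "und_edges G = {{u, v} | u v. (u, v) \<in> parcs G \<or> (v, u) \<in> parcs G}"

text \<open>The pair \<open>(u, v)\<close> is the directed edge with initial vertex \<open>u\<close> and terminal vertex \<open>v\<close>.\<close>

definition dir_edges :: "'v pair_pre_digraph \<Rightarrow> ('v \<times> 'v) set" where
  "dir_edges G = {(u, v). {u, v} \<in> und_edges G}"

definition nbrs_from :: "'v pair_pre_digraph \<Rightarrow> 'v \<Rightarrow> 'v set" where
  "nbrs_from G u = {v. one_way G v u}"

definition nbrs_to :: "'v pair_pre_digraph \<Rightarrow> 'v \<Rightarrow> 'v set" where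
  "nbrs_to G u = {v. one_way G u v}"

definition nbrs_both :: "'v pair_pre_digraph \<Rightarrow> 'v \<Rightarrow> 'v set" where
  "nbrs_both G u = {v. two_way G u v}"

definition nbrs :: "'v pair_pre_digraph \<Rightarrow> 'v \<Rightarrow> 'v set" where
  "nbrs G u = nbrs_from G u \<union> nbrs_to G u \<union> nbrs_both G u"

definition deg_mat :: "'v pair_pre_digraph \<Rightarrow> 'v \<Rightarrow> 'v \<Rightarrow> complex" where
  "deg_mat G = diag (\<lambda>u. of_nat (card (nbrs G u)))"

definition herm_adj :: "'v pair_pre_digraph \<Rightarrow> complex \<Rightarrow> 'v \<Rightarrow> 'v \<Rightarrow> complex" where
  "herm_adj G \<alpha> = (\<lambda>u v.
     if two_way G u v then 1
     else if one_way G u v then \<alpha>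
     else if one_way G v u then cnj \<alpha>
     else 0)"

definition nonback :: "'v \<times> 'v \<Rightarrow> 'v \<times> 'v \<Rightarrow> real" where
  "nonback e f = (if snd e = fst f \<and> fst e \<noteq> snd f then 1 else 0)"

text \<open>On \<open>dir_edges G\<close> one of the first three cases below always applies.\<close>

definition edge_weight :: "'v pair_pre_digraph \<Rightarrow> complex \<Rightarrow> 'v \<times> 'v \<Rightarrow> complex" where
  "edge_weight G \<alpha> e =
     (if two_way G (fst e) (snd e) then 1
      else if one_way G (fst e) (snd e) then \<alpha>
      else if one_way G (snd e) (fst e) then cnj \<alpha>
      else 0)"

definition herm_nonback ::
  "'v pair_pre_digraph \<Rightarrow> complex \<Rightarrow> 'v \<times> 'v \<Rightarrow> 'v \<times> 'v \<Rightarrow> complex" where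
  "herm_nonback G \<alpha> =
     mat_mul (dir_edges G) (\<lambda>e f. complex_of_real (nonback e f)) (diag (edge_weight G \<alpha>))"

definition in_vec :: "'v pair_pre_digraph \<Rightarrow> ('v \<times> 'v \<Rightarrow> complex) \<Rightarrow> 'v \<Rightarrow> complex" where
  "in_vec G g u = (\<Sum>v\<in>nbrs G u. g (v, u))"

definition out_vec ::
  "'v pair_pre_digraph \<Rightarrow> complex \<Rightarrow> ('v \<times> 'v \<Rightarrow> complex) \<Rightarrow> 'v \<Rightarrow> complex" where
  "out_vec G \<alpha> g u =
     (\<Sum>v\<in>nbrs_both G u. g (u, v)) + \<alpha> * (\<Sum>v\<in>nbrs_to G u. g (u, v))
       + cnj \<alpha> * (\<Sum>v\<in>nbrs_from G u. g (u, v))"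

end

(*
  On a directed edge, the weight is the entry of the Hermitian adjacency matrix h, so the
  non-backtracking operator acts by (B g)(u, v) = out(v) - h v u * g (v, u).
  Weighted summation over the edges leaving u, with h u v * h v u = |alpha|^2 = 1, gives the
  first block row; summation over the edges entering u gives the second.
*)
theory Submission
  imports Defs
begin

lemma in_nbrs_iff: "v \<in> nbrs G u \<longleftrightarrow> (u, v) \<in> parcs G \<or> (v, u) \<in> parcs G"
  by (auto simp: nbrs_def nbrs_from_def nbrs_to_def nbrs_both_def one_way_def two_way_def)

lemma dir_edges_iff: "(u, v) \<in> dir_edges G \<longleftrightarrow> v \<in> nbrs G u"
  by (auto simp: dir_edges_def und_edges_def in_nbrs_iff doubleton_eq_iff)

lemma in_nbrs_commute: "v \<in> nbrs G u \<longleftrightarrow> u \<in> nbrs G v"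
  by (auto simp: in_nbrs_iff)

lemma edge_weight_eq_herm_adj: "edge_weight G \<alpha> (u, v) = herm_adj G \<alpha> u v"
  by (simp add: edge_weight_def herm_adj_def)

lemma herm_adj_eq_0: "v \<notin> nbrs G u \<Longrightarrow> herm_adj G \<alpha> u v = 0"
  by (auto simp: herm_adj_def in_nbrs_iff one_way_def two_way_def)

text \<open>The two entries are conjugate: both are 1 on a two-way edge, and they are \<alpha> and
  \<open>cnj \<alpha>\<close> on a one-way edge. Either way their product is a squared
  modulus.\<close>

lemma herm_adj_mult_swap:
  assumes "norm \<alpha> = 1" "v \<in> nbrs G u"
  shows "herm_adj G \<alpha> u v * herm_adj G \<alpha> v u = 1"
proof -
  have "\<alpha> * cnj \<alpha> = 1"
    using assms(1) by (simp add: complex_norm_square [symmetric])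
  then show ?thesis
    using assms(2) by (auto simp: herm_adj_def in_nbrs_iff one_way_def two_way_def mult.commute)
qed

context pair_fin_digraph
begin

lemma nbrs_subset_pverts: "nbrs G u \<subseteq> pverts G"
  by (auto simp: in_nbrs_iff dest: in_arcsD1 in_arcsD2)

lemma finite_nbrs: "finite (nbrs G u)"
  using finite_subset [OF nbrs_subset_pverts] by auto

lemma finite_dir_edges: "finite (dir_edges G)"
proof (rule finite_subset)
  show "dir_edges G \<subseteq> pverts G \<times> pverts G"
    using nbrs_subset_pverts in_nbrs_commute by (fastforce simp: dir_edges_iff)
qed auto

text \<open>The three kinds of neighbours are pairwise disjoint, and
  \<open>herm_adj G \<alpha> u\<close> is constant on each, with the coefficient that
  \<open>out_vec\<close> puts there.\<close>

lemma out_vec_eq_sum: "out_vec G \<alpha> g u = (\<Sum>v\<in>nbrs G u. herm_adj G \<alpha> u v * g (u, v))"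
proof -
  have fin: "finite (nbrs_both G u)" "finite (nbrs_to G u)" "finite (nbrs_from G u)"
    using finite_nbrs [of u] by (auto simp: nbrs_def)
  have "(\<Sum>v\<in>nbrs G u. herm_adj G \<alpha> u v * g (u, v)) =
      (\<Sum>v\<in>nbrs_from G u. herm_adj G \<alpha> u v * g (u, v))
      + (\<Sum>v\<in>nbrs_to G u. herm_adj G \<alpha> u v * g (u, v))
      + (\<Sum>v\<in>nbrs_both G u. herm_adj G \<alpha> u v * g (u, v))"
    unfolding nbrs_def using fin
    by (subst sum.union_disjoint;
        auto simp: sum.union_disjoint nbrs_from_def nbrs_to_def nbrs_both_def
          one_way_def two_way_def)+
  also have "\<dots> = (\<Sum>v\<in>nbrs_from G u. cnj \<alpha> * g (u, v))
      + (\<Sum>v\<in>nbrs_to G u. \<alpha> * g (u, v)) + (\<Sum>v\<in>nbrs_both G u. g (u, v))"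
    by (intro arg_cong2 [of _ _ _ _ "(+)"] sum.cong)
      (auto simp: herm_adj_def nbrs_from_def nbrs_to_def nbrs_both_def one_way_def two_way_def)
  finally show ?thesis
    by (simp add: out_vec_def sum_distrib_left)
qed

text \<open>Right multiplication by a diagonal matrix scales columns; the column index must lie in
  the summation range for its diagonal entry to be met.\<close>

lemma herm_nonback_apply:
  assumes "f \<in> dir_edges G"
  shows "herm_nonback G \<alpha> e f = complex_of_real (nonback e f) * edge_weight G \<alpha> f"
  using assms finite_dir_edges
  by (simp add: herm_nonback_def mat_mul_def diag_def if_distrib [of "\<lambda>x. _ * x"] cong: if_cong)

lemma mat_vec_herm_nonback:
  assumes "v \<in> nbrs G u"
  shows "mat_vec (dir_edges G) (herm_nonback G \<alpha>) g (u, v) =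
    out_vec G \<alpha> g v - herm_adj G \<alpha> v u * g (v, u)"
proof -
  have "mat_vec (dir_edges G) (herm_nonback G \<alpha>) g (u, v) =
      (\<Sum>f\<in>dir_edges G. complex_of_real (nonback (u, v) f) * edge_weight G \<alpha> f * g f)"
    unfolding mat_vec_def by (intro sum.cong) (auto simp: herm_nonback_apply)
  \<comment> \<open>Row \<open>(u, v)\<close> of \<open>nonback\<close> is supported on the edges
    that leave \<open>v\<close> and do not return to \<open>u\<close>.\<close>
  also have "\<dots> = (\<Sum>f\<in>Pair v ` (nbrs G v - {u}).
      complex_of_real (nonback (u, v) f) * edge_weight G \<alpha> f * g f)"
    using finite_dir_edges
    by (intro sum.mono_neutral_right) (auto simp: dir_edges_iff nonback_def)
  also have "\<dots> = (\<Sum>w\<in>nbrs G v - {u}. herm_adj G \<alpha> v w * g (v, w))"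
    by (subst sum.reindex)
      (auto simp: inj_on_def nonback_def edge_weight_eq_herm_adj intro!: sum.cong split: if_splits)
  \<comment> \<open>Since \<open>u\<close> is a neighbour of \<open>v\<close>, leaving it out
    removes exactly one term of the full sum, the backtracking one.\<close>
  also have "\<dots> = out_vec G \<alpha> g v - herm_adj G \<alpha> v u * g (v, u)"
    using assms finite_nbrs by (simp add: out_vec_eq_sum sum_diff1 in_nbrs_commute [of u])
  finally show ?thesis .
qed

lemma out_vec_herm_nonback:
  assumes "norm \<alpha> = 1"
  shows "out_vec G \<alpha> (mat_vec (dir_edges G) (herm_nonback G \<alpha>) g) u =
    (\<Sum>v\<in>pverts G. herm_adj G \<alpha> u v * out_vec G \<alpha> g v) - in_vec G g u"
proof -
  have "out_vec G \<alpha> (mat_vec (dir_edges G) (herm_nonback G \<alpha>) g) u =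
      (\<Sum>v\<in>nbrs G u. herm_adj G \<alpha> u v * (out_vec G \<alpha> g v - herm_adj G \<alpha> v u * g (v, u)))"
    \<comment> \<open>The instantiation expands only the outer \<open>out_vec\<close>; the inner
      \<open>out_vec G \<alpha> g v\<close> has to survive.\<close>
    by (simp add: out_vec_eq_sum [of _ "mat_vec _ _ _"] mat_vec_herm_nonback)
  also have "\<dots> = (\<Sum>v\<in>nbrs G u. herm_adj G \<alpha> u v * out_vec G \<alpha> g v - g (v, u))"
    by (intro sum.cong)
      (auto simp: right_diff_distrib mult.assoc [symmetric] herm_adj_mult_swap [OF assms])
  also have "\<dots> = (\<Sum>v\<in>nbrs G u. herm_adj G \<alpha> u v * out_vec G \<alpha> g v) - in_vec G g u"
    by (simp add: sum_subtractf in_vec_def)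
  \<comment> \<open>Entries of \<open>herm_adj\<close> vanish off the neighbourhood, so the sum
    extends to a full matrix row.\<close>
  also have "(\<Sum>v\<in>nbrs G u. herm_adj G \<alpha> u v * out_vec G \<alpha> g v) =
      (\<Sum>v\<in>pverts G. herm_adj G \<alpha> u v * out_vec G \<alpha> g v)"
    using nbrs_subset_pverts by (intro sum.mono_neutral_left) (auto simp: herm_adj_eq_0)
  finally show ?thesis .
qed

text \<open>Each edge entering \<open>u\<close> contributes one copy of the out-value at
  \<open>u\<close>, and the backtracking terms together make up one more copy, subtracted. The
  difference is taken in the complex numbers, so an isolated vertex gets the factor -1, multiplied
  by an empty sum.\<close>

lemma in_vec_herm_nonback:
  "in_vec G (mat_vec (dir_edges G) (herm_nonback G \<alpha>) g) u =
    (of_nat (card (nbrs G u)) - 1) * out_vec G \<alpha> g u"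
proof -
  have "in_vec G (mat_vec (dir_edges G) (herm_nonback G \<alpha>) g) u =
      (\<Sum>v\<in>nbrs G u. out_vec G \<alpha> g u - herm_adj G \<alpha> u v * g (u, v))"
    unfolding in_vec_def
    by (intro sum.cong) (auto simp: mat_vec_herm_nonback in_nbrs_commute [of u])
  also have "\<dots> = of_nat (card (nbrs G u)) * out_vec G \<alpha> g u - out_vec G \<alpha> g u"
    by (simp add: sum_subtractf out_vec_eq_sum [symmetric])
  finally show ?thesis
    by (simp add: left_diff_distrib)
qed

end

text \<open>A sum over \<open>I <+> J\<close> splits into its \<open>Inl\<close> and
  \<open>Inr\<close> parts, which reduces the block identity to its two rows.\<close>

lemma mat_vec_block:
  assumes "finite I" "finite J"
  shows "mat_vec (I <+> J) (block_mat P Q R S) (block_vec x y) =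
    block_vec (\<lambda>i. mat_vec I P x i + mat_vec J Q y i) (\<lambda>j. mat_vec I R x j + mat_vec J S y j)"
  using assms
  by (auto simp: fun_eq_iff mat_vec_def block_mat_def block_vec_def sum.Plus split: sum.splits)

lemma mat_vec_diag:
  assumes "finite I" "i \<in> I"
  shows "mat_vec I (diag d) x i = d i * x i"
  using assms by (simp add: mat_vec_def diag_def if_distrib [of "\<lambda>x. x * _"] cong: if_cong)

theorem theorem1:
  fixes G :: "'v pair_pre_digraph" and \<alpha> :: complex and g :: "'v \<times> 'v \<Rightarrow> complex"
  assumes "pair_digraph G"
    and "\<exists>n::nat. n > 0 \<and> \<alpha> ^ n = 1"
  defines "V \<equiv> pverts G" and "Bg \<equiv> mat_vec (dir_edges G) (herm_nonback G \<alpha>) g"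
  shows "\<forall>i \<in> V <+> V.
    block_vec (out_vec G \<alpha> Bg) (in_vec G Bg) i =
      mat_vec (V <+> V)
        (block_mat (herm_adj G \<alpha>) (- id_mat) (deg_mat G - id_mat) zero_mat)
        (block_vec (out_vec G \<alpha> g) (in_vec G g)) i"
proof -
  interpret pair_digraph G by fact
  have fin: "finite V"
    by (simp add: V_def)
  obtain n :: nat where "n > 0" "\<alpha> ^ n = 1"
    using assms(2) by blast
  \<comment> \<open>Roots of unity lie on the unit circle, which gives the cancellation in the first
    block row.\<close>
  then have norm: "norm \<alpha> = 1"
    using power_eq_1_iff [of \<alpha> n] by auto
  \<comment> \<open>Written as diagonal matrices, \<open>- id_mat\<close> and
    \<open>deg_mat G - id_mat\<close> act entrywise by \<open>mat_vec_diag\<close>.\<close>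
  have neg_id: "(- id_mat :: 'v \<Rightarrow> 'v \<Rightarrow> complex) = diag (\<lambda>_. - 1)"
    by (auto simp: fun_eq_iff id_mat_def diag_def)
  have deg_id: "deg_mat G - id_mat = diag (\<lambda>u. of_nat (card (nbrs G u)) - 1)"
    by (auto simp: fun_eq_iff deg_mat_def id_mat_def diag_def)
  have "out_vec G \<alpha> Bg u =
      mat_vec V (herm_adj G \<alpha>) (out_vec G \<alpha> g) u + mat_vec V (- id_mat) (in_vec G g) u"
    if "u \<in> V" for u
    unfolding neg_id mat_vec_diag [OF fin that] Bg_def out_vec_herm_nonback [OF norm]
    by (simp add: V_def mat_vec_def)
  moreover have "in_vec G Bg u =
      mat_vec V (deg_mat G - id_mat) (out_vec G \<alpha> g) u + mat_vec V zero_mat (in_vec G g) u"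
    if "u \<in> V" for u
    unfolding deg_id mat_vec_diag [OF fin that] Bg_def in_vec_herm_nonback
    by (simp add: mat_vec_def zero_mat_def)
  ultimately show ?thesis
    unfolding mat_vec_block [OF fin fin] by (auto simp: block_vec_def)
qed

end
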